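(* Let $a$ and $b$ be positive integers with $\gcd(a,b)=1$, let $\lambda\in\mathbb{C}$ with $\lambda\neq 0$, $\lambda^a=1$ and $\lambda^b\neq 1$, and let $m$ be a nonnegative integer. Then \begin{align*} S_m^{(\lambda)}(a,b)&=\sum_{\ell=0}^{m+1}\sum_{i=0}^\ell\binom{m+1}{\ell}\binom{\ell}{i}\frac{a^{m-\ell+i+1}b^{m-i+1}}{(m-\ell+2)(m+1)\lambda}B_i\,\mathcal B_{\ell-i}(\lambda^b)\\ &\quad -\frac{\mathcal B_{m+1}(\lambda)}{(m+1)\lambda}. \end{align*}
   Context: For coprime positive integers $a,b$, $\mathrm{NR}(a,b)$ denotes the (finite) set of all nonnegative integers $n$ that cannot be expressed in the form $n=ax+by$ with $x,y$ nonnegative integers. (Since $0$ is representable, all elements are positive.) For a nonnegative integer $m$ and $\lambda\neq 0$, $$S_m^{(\lambda)}(a,b):=\sum_{n\in \mathrm{NR}(a,b)}\lambda^{n-1}n^m.$$ For a complex number $\mu\neq 1$, the Apostol-Bernoulli numbers $\mathcal B_n(\mu)$ ($n\ge 0$) are defined by the power series expansion at $z=0$ $$\frac{z}{\mu e^z-1}=\sum_{n=0}^\infty \mathcal B_n(\mu)\frac{z^n}{n!}.$$ For example, $\mathcal B_0(\mu)=0$, $\mathcal B_1(\mu)=\frac{1}{\mu-1}$, $\mathcal B_2(\mu)=-\frac{2\mu}{(\mu-1)^2}$. The $B_n$ are the classical Bernoulli numbers, defined by $\frac{z}{e^z-1}=\sum_{n=0}^\infty B_n\frac{z^n}{n!}$,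 so $B_0=1$, $B_1=-\frac12$, $B_2=\frac16$. *)

theory Defs
  imports Complex_Main "HOL-Computational_Algebra.Formal_Power_Series"
begin

definition NR :: "nat \<Rightarrow> nat \<Rightarrow> nat set" where
  "NR a b = {n. \<not> (\<exists>x y. n = a * x + b * y)}"

(* NR a b is finite for coprime positive a, b. The truncated exponent n - 1 is harmless:
   0 is not in NR a b. *)
definition weighted_sylvester_sum :: "complex \<Rightarrow> nat \<Rightarrow> nat \<Rightarrow> nat \<Rightarrow> complex" where
  "weighted_sylvester_sum lam m a b = (\<Sum>n\<in>NR a b. lam ^ (n - 1) * of_nat n ^ m)"

(* Numbers defined by an exponential generating function are read off from the quotient
   of formal power series in the indeterminate z = fps_X. For mu different from 1 the denominator
   is a unit; the value at mu = 1 is not used. *)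
definition apostol_bernoulli :: "nat \<Rightarrow> complex \<Rightarrow> complex" where
  "apostol_bernoulli n \<mu> = fact n * fps_nth (fps_X / (fps_const \<mu> * fps_exp 1 - 1)) n"

(* Here the denominator has subdegree 1 and the division cancels the common factor fps_X,
   so that the quotient is the expansion of z / (exp z - 1) with B 1 = - 1/2. *)
definition bernoulli_number :: "nat \<Rightarrow> complex" where
  "bernoulli_number n = fact n * fps_nth (fps_X / (fps_exp 1 - 1)) n"

lemma zero_not_in_NR: "0 \<notin> NR a b"
  by (auto simp: NR_def)

lemma apostol_bernoulli_gf:
  assumes "\<mu> \<noteq> 1"
  shows "Abs_fps (\<lambda>n. apostol_bernoulli n \<mu> / fact n) * (fps_const \<mu> * fps_exp 1 - 1) = fps_X"
proof -
  let ?D = "fps_const \<mu> * fps_exp 1 - 1 :: complex fps"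
  have "fps_nth ?D 0 \<noteq> 0" using assms by simp
  then have "fps_X / ?D * ?D = fps_X"
    by (simp add: fps_divide_unit mult.assoc inverse_mult_eq_1)
  moreover have "Abs_fps (\<lambda>n. apostol_bernoulli n \<mu> / fact n) = fps_X / ?D"
    by (rule fps_ext) (simp add: apostol_bernoulli_def)
  ultimately show ?thesis by simp
qed

lemma bernoulli_number_gf:
  "Abs_fps (\<lambda>n. bernoulli_number n / fact n) * (fps_exp 1 - 1) = fps_X"
proof -
  let ?D = "fps_exp 1 - 1 :: complex fps"
  have nz: "fps_nth ?D 1 \<noteq> 0" by simp
  then have "?D \<noteq> 0" by (metis fps_zero_nth)
  moreover have "subdegree ?D \<le> subdegree (fps_X :: complex fps)"
    using nz by (simp add: subdegree_leI)
  ultimately have "?D dvd fps_X" by (simp add: fps_dvd_iff)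
  then have "fps_X / ?D * ?D = fps_X" by simp
  moreover have "Abs_fps (\<lambda>n. bernoulli_number n / fact n) = fps_X / ?D"
    by (rule fps_ext) (simp add: bernoulli_number_def)
  ultimately show ?thesis by simp
qed

end

theory Submission
  imports Defs "HOL-Number_Theory.Cong"
begin

text \<open>Adding \<open>a\<close> to every gap of the semigroup generated by \<open>a\<close> and \<open>b\<close> and adjoining
  \<open>0, \<dots>, a - 1\<close> gives the same set as adjoining \<open>0, b, \<dots>, (a - 1) b\<close> to the gaps.
  Summing \<open>e\<^sup>n\<close> over both sides and evaluating the geometric series yields
  \<open>\<Sum> e\<^sup>n = (e\<^sup>a\<^sup>b - 1) / ((e\<^sup>a - 1) (e\<^sup>b - 1)) - 1 / (e - 1)\<close>, the left sum over the gaps.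
  For \<open>e = \<lambda> exp z\<close> one has \<open>e\<^sup>a = exp (a z)\<close>, so that, after multiplication by \<open>z\<close>, the factors are
  generating functions of Bernoulli and Apostol-Bernoulli numbers, and the theorem is the
  comparison of the coefficients of \<open>z\<^sup>m\<^sup>+\<^sup>1\<close>.\<close>

section \<open>Gaps of the semigroup generated by \<open>a\<close> and \<open>b\<close>\<close>

lemma reduced_representation:
  assumes "a > 0" and "n \<notin> NR a b"
  obtains x y where "y < a" and "n = a * x + b * y"
proof -
  from assms obtain x y where n: "n = a * x + b * y" by (auto simp: NR_def)
  \<comment> \<open>Whole multiples of \<open>a\<close> in the coefficient of \<open>b\<close> are
    moved into the coefficient of \<open>a\<close>.\<close>
  have "b * y = b * (a * (y div a)) + b * (y mod a)" by (metis distrib_left mult_div_mod_eq)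
  then have "n = a * (x + b * (y div a)) + b * (y mod a)"
    using n by (simp add: distrib_left mult.left_commute)
  then show ?thesis using that[of "y mod a" "x + b * (y div a)"] assms(1) by simp
qed

text \<open>No gap reaches \<open>a * b\<close>: for larger \<open>n\<close> some
  \<open>y < a\<close> solves \<open>b * y = n\<close> modulo \<open>a\<close>, and
  \<open>n - b * y\<close> is then a nonnegative multiple of \<open>a\<close>.\<close>

lemma finite_NR:
  assumes "a > 0" and "coprime a b"
  shows "finite (NR a b)"
proof (rule finite_subset)
  show "NR a b \<subseteq> {..<a * b}"
  proof (rule subsetI, rule ccontr)
    fix n assume n: "n \<in> NR a b" "n \<notin> {..<a * b}"
    obtain z where z: "[b * z = 1] (mod a)"
      using cong_solve_coprime_nat[of b a] assms(2) by (auto simp: coprime_commute)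
    define y where "y = (z * n) mod a"
    have "[b * y = b * (z * n)] (mod a)"
      unfolding y_def by (intro cong_mult) (auto simp: cong_def)
    also have "b * (z * n) = b * z * n" by simp
    also have "[b * z * n = 1 * n] (mod a)" by (intro cong_mult z cong_refl)
    finally have c: "[n = b * y] (mod a)" by (simp add: cong_sym_eq)
    have "y < a" using assms(1) by (simp add: y_def)
    then have "b * y \<le> a * b" by (simp only: mult.commute[of a b] mult_le_mono2 less_imp_le)
    then have le: "b * y \<le> n" using n(2) by (simp only: lessThan_iff not_less)
    have "a dvd n - b * y" using c le by (simp add: cong_altdef_nat)
    then obtain x where "n - b * y = a * x" by (elim dvdE)
    then have "n = a * x + b * y" using le by simp
    with n(1) show False by (auto simp: NR_def)
  qed
qed simp

text \<open>The multiples \<open>b * j\<close> with \<open>j < a\<close> are the Apery set of the semigroup with respect to \<open>a\<close>: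
  the least representable number in each residue class modulo \<open>a\<close>.\<close>

lemma NR_shift:
  assumes "a > 0" and "b > 0" and "coprime a b"
  shows "(\<lambda>n. n + a) ` NR a b \<union> {..<a} = NR a b \<union> (\<lambda>j. b * j) ` {..<a}"
proof (intro equalityI subsetI)
  fix x assume "x \<in> (\<lambda>n. n + a) ` NR a b \<union> {..<a}"
  then consider n where "n \<in> NR a b" "x = n + a" | "x < a" by auto
  then show "x \<in> NR a b \<union> (\<lambda>j. b * j) ` {..<a}"
  proof cases
    case 1
    show ?thesis
    proof (cases "x \<in> NR a b")
      case False
      then obtain u y where u: "y < a" "x = a * u + b * y"
        using reduced_representation assms(1) by blast
      \<comment> \<open>A positive \<open>u\<close> could be lowered by one, which would represent
        the gap \<open>n\<close>.\<close>
      have "u = 0"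
      proof (rule ccontr)
        assume "u \<noteq> 0"
        then have "n = a * (u - 1) + b * y" using u 1 by (cases u) auto
        with 1 show False by (auto simp: NR_def)
      qed
      with u show ?thesis by auto
    qed simp
  next
    case 2
    show ?thesis
    proof (cases "x \<in> NR a b")
      case False
      then obtain u y where u: "y < a" "x = a * u + b * y"
        using reduced_representation assms(1) by blast
      with 2 have "u = 0" by (cases u) auto
      with u show ?thesis by auto
    qed simp
  qed
next
  fix x assume x: "x \<in> NR a b \<union> (\<lambda>j. b * j) ` {..<a}"
  show "x \<in> (\<lambda>n. n + a) ` NR a b \<union> {..<a}"
  proof (cases "x < a")
    case False
    \<comment> \<open>Otherwise \<open>x\<close> is representable too, hence some
      \<open>b * j\<close> with \<open>j < a\<close>. Modulo \<open>a\<close> this forces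
      \<open>j = y\<close>, which contradicts the extra summand \<open>a * Suc u\<close>.\<close>
    have "x - a \<in> NR a b"
    proof (rule ccontr)
      assume "x - a \<notin> NR a b"
      then obtain u y where u: "y < a" "x - a = a * u + b * y"
        using reduced_representation assms(1) by blast
      have x': "x = a * Suc u + b * y" using u(2) False by simp
      then have "x \<notin> NR a b" unfolding NR_def by blast
      with x obtain j where j: "j < a" "x = b * j" by auto
      have "b * j mod a = b * y mod a" using x' j by (metis mod_mult_self4)
      then have "[j = y] (mod a)"
        using cong_mult_lcancel_nat[of b a j y] assms(3)
        by (simp add: cong_def coprime_commute)
      then have "j = y" using j u by (simp add: cong_def)
      with x' j assms(1) show False by simp
    qed
    then show ?thesis using False by (auto intro!: image_eqI[of _ _ "x - a"])
  qed simp
qed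

text \<open>Both unions in \<open>NR_shift\<close> are disjoint: \<open>n + a\<close> is at least
  \<open>a\<close>, and a multiple of \<open>b\<close> is never a gap.\<close>

lemma sum_NR_shift:
  fixes f :: "nat \<Rightarrow> 'a::comm_monoid_add"
  assumes "a > 0" and "b > 0" and "coprime a b"
  shows "(\<Sum>n\<in>NR a b. f (n + a)) + (\<Sum>r<a. f r) = (\<Sum>n\<in>NR a b. f n) + (\<Sum>j<a. f (b * j))"
proof -
  have fin: "finite (NR a b)" using finite_NR assms by blast
  have "(\<Sum>n\<in>NR a b. f (n + a)) + (\<Sum>r<a. f r) = sum f ((\<lambda>n. n + a) ` NR a b \<union> {..<a})"
    using fin by (subst sum.union_disjoint) (auto simp: sum.reindex)
  also have "\<dots> = sum f (NR a b \<union> (\<lambda>j. b * j) ` {..<a})"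
    using NR_shift[OF assms] by simp
  also have "\<dots> = (\<Sum>n\<in>NR a b. f n) + sum f ((\<lambda>j. b * j) ` {..<a})"
  proof (rule sum.union_disjoint)
    show "NR a b \<inter> (\<lambda>j. b * j) ` {..<a} = {}"
      by (auto simp: NR_def) (metis add_0 mult_0_right)
  qed (use fin in auto)
  also have "sum f ((\<lambda>j. b * j) ` {..<a}) = (\<Sum>j<a. f (b * j))"
    using assms(2) by (subst sum.reindex) (auto simp: inj_on_def)
  finally show ?thesis .
qed

text \<open>Clearing denominators makes the identity valid in every commutative ring, in particular
  for power series, where \<open>e ^ a - 1\<close> need not be a unit.\<close>

lemma NR_generating_function:
  fixes e :: "'a::comm_ring_1"
  assumes "a > 0" and "b > 0" and "coprime a b"
  shows "(\<Sum>n\<in>NR a b. e ^ n) * (e ^ a - 1) * (e ^ b - 1) * (e - 1)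
    = (e ^ (a * b) - 1) * (e - 1) - (e ^ a - 1) * (e ^ b - 1)"
proof -
  let ?W = "\<Sum>n\<in>NR a b. e ^ n"
  have "?W * e ^ a + (\<Sum>r<a. e ^ r) = ?W + (\<Sum>j<a. (e ^ b) ^ j)"
    using sum_NR_shift[OF assms, of "\<lambda>n. e ^ n"]
    by (simp add: power_add power_mult sum_distrib_right)
  then have W: "?W * (e ^ a - 1) = (\<Sum>j<a. (e ^ b) ^ j) - (\<Sum>r<a. e ^ r)"
    by (simp add: algebra_simps)
  have g1: "(e - 1) * (\<Sum>r<a. e ^ r) = e ^ a - 1" by (rule power_diff_1_eq [symmetric])
  have g2: "(e ^ b - 1) * (\<Sum>j<a. (e ^ b) ^ j) = e ^ (a * b) - 1"
    using power_diff_1_eq[of "e ^ b" a] by (simp add: power_mult [symmetric] mult.commute)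
  have "?W * (e ^ a - 1) * (e ^ b - 1) * (e - 1)
      = (e ^ b - 1) * (\<Sum>j<a. (e ^ b) ^ j) * (e - 1) - (e - 1) * (\<Sum>r<a. e ^ r) * (e ^ b - 1)"
    unfolding W by (simp add: algebra_simps)
  then show ?thesis unfolding g1 g2 .
qed

section \<open>Generating functions in the variable \<open>fps_X\<close>\<close>

lemma bernoulli_number_gf_scaled:
  "Abs_fps (\<lambda>n. c ^ n * bernoulli_number n / fact n) * (fps_exp c - 1) = fps_const c * fps_X"
proof -
  let ?c = "fps_const c * fps_X"
  \<comment> \<open>The argument \<open>z\<close> is replaced by \<open>c * z\<close> in the
    unscaled identity.\<close>
  have "(Abs_fps (\<lambda>n. bernoulli_number n / fact n) * (fps_exp 1 - 1)) oo ?c = fps_X oo ?c"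
    by (simp only: bernoulli_number_gf)
  then have "(Abs_fps (\<lambda>n. bernoulli_number n / fact n) oo ?c) * (fps_exp c - 1) = ?c"
    by (simp add: fps_compose_mult_distrib fps_compose_sub_distrib)
  moreover have "Abs_fps (\<lambda>n. bernoulli_number n / fact n) oo ?c
      = Abs_fps (\<lambda>n. c ^ n * bernoulli_number n / fact n)"
    by (simp add: fps_compose_linear)
  ultimately show ?thesis by simp
qed

lemma apostol_bernoulli_gf_scaled:
  assumes "\<mu> \<noteq> 1"
  shows "Abs_fps (\<lambda>n. c ^ n * apostol_bernoulli n \<mu> / fact n) * (fps_const \<mu> * fps_exp c - 1)
    = fps_const c * fps_X"
proof -
  let ?c = "fps_const c * fps_X"
  have "(Abs_fps (\<lambda>n. apostol_bernoulli n \<mu> / fact n) * (fps_const \<mu> * fps_exp 1 - 1)) oo ?c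
      = fps_X oo ?c"
    using apostol_bernoulli_gf[OF assms] by simp
  then have "(Abs_fps (\<lambda>n. apostol_bernoulli n \<mu> / fact n) oo ?c)
      * (fps_const \<mu> * fps_exp c - 1) = ?c"
    by (simp add: fps_compose_mult_distrib fps_compose_sub_distrib)
  moreover have "Abs_fps (\<lambda>n. apostol_bernoulli n \<mu> / fact n) oo ?c
      = Abs_fps (\<lambda>n. c ^ n * apostol_bernoulli n \<mu> / fact n)"
    by (simp add: fps_compose_linear)
  ultimately show ?thesis by simp
qed

lemma fps_const_mult_exp_power:
  "(fps_const c * fps_exp 1) ^ n = fps_const (c ^ n) * fps_exp (of_nat n :: 'a::field_char_0)"
  by (simp add: power_mult_distrib fps_exp_power_mult)

text \<open>The factor \<open>lam\<close> makes up for the exponent \<open>n - 1\<close> in the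
  weighted sum; every gap is positive, so the subtraction is not truncated.\<close>

lemma NR_exponential_sum_nth:
  assumes "lam \<noteq> 0"
  shows "fps_nth (\<Sum>n\<in>NR a b. (fps_const lam * fps_exp 1) ^ n) m
    = lam * weighted_sylvester_sum lam m a b / fact m"
proof -
  have summand: "lam ^ n * of_nat n ^ m / fact m = lam * (lam ^ (n - 1) * of_nat n ^ m) / fact m"
    if "n \<in> NR a b" for n
    using that zero_not_in_NR[of a b] by (cases n) auto
  have "fps_nth (\<Sum>n\<in>NR a b. (fps_const lam * fps_exp 1) ^ n) m
      = (\<Sum>n\<in>NR a b. lam ^ n * of_nat n ^ m / fact m)"
    by (simp add: fps_sum_nth fps_const_mult_exp_power)
  also have "\<dots> = (\<Sum>n\<in>NR a b. lam * (lam ^ (n - 1) * of_nat n ^ m) / fact m)"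
    using summand by (rule sum.cong[OF refl])
  finally show ?thesis
    by (simp add: weighted_sylvester_sum_def sum_distrib_left sum_divide_distrib)
qed

lemma weighted_sylvester_gf:
  fixes a b :: nat and lam :: complex
  assumes "a > 0" and "b > 0" and "coprime a b" and "lam ^ a = 1" and "lam ^ b \<noteq> 1"
  defines "c \<equiv> (of_nat (a * b) :: complex)"
  shows "fps_const c * (fps_X * (\<Sum>n\<in>NR a b. (fps_const lam * fps_exp 1) ^ n)
      + Abs_fps (\<lambda>n. apostol_bernoulli n lam / fact n))
    = Abs_fps (\<lambda>n. of_nat a ^ n * bernoulli_number n / fact n)
      * Abs_fps (\<lambda>n. of_nat b ^ n * apostol_bernoulli n (lam ^ b) / fact n)
      * Abs_fps (\<lambda>n. c ^ Suc n / fact (Suc n))"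
    (is "?C * (fps_X * ?W + ?L) = ?P * ?Q * ?H")
proof -
  have "lam \<noteq> 1" using assms(5) by auto
  define e where "e = fps_const lam * fps_exp 1"
  define u v w where "u = e ^ a - 1" and "v = e ^ b - 1" and "w = e - 1"
  have L: "?L * w = fps_X"
    unfolding w_def e_def using apostol_bernoulli_gf[OF \<open>lam \<noteq> 1\<close>] .
  have P: "?P * u = fps_const (of_nat a) * fps_X"
    unfolding u_def e_def fps_const_mult_exp_power assms(4)
    using bernoulli_number_gf_scaled[of "of_nat a"] by simp
  have Q: "?Q * v = fps_const (of_nat b) * fps_X"
    unfolding v_def e_def fps_const_mult_exp_power
    by (rule apostol_bernoulli_gf_scaled) (fact assms(5))
  \<comment> \<open>Since \<open>lam ^ a = 1\<close>, the left side is \<open>fps_exp c - 1\<close>;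
    its constant term vanishes, and \<open>?H\<close> is its quotient by
    \<open>fps_X\<close>.\<close>
  have H: "e ^ (a * b) - 1 = fps_X * ?H"
  proof -
    have "e ^ (a * b) = fps_exp c"
      unfolding e_def fps_const_mult_exp_power c_def by (simp add: power_mult assms(4))
    then show ?thesis by (auto intro!: fps_ext simp: not_less_eq gr0_conv_Suc)
  qed
  have W: "?W * u * v * w = fps_X * ?H * w - u * v"
    using NR_generating_function[OF assms(1-3), of e] unfolding u_def v_def w_def H
    unfolding e_def .
  have C: "?C = fps_const (of_nat a) * fps_const (of_nat b)" by (simp add: c_def)
  \<comment> \<open>Each is a factor of a nonzero multiple of \<open>fps_X\<close>, so
    \<open>u * v * w\<close> can be cancelled at the end.\<close>
  have nz: "u \<noteq> 0" "v \<noteq> 0" "w \<noteq> 0"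
    using L P Q assms(1,2) by auto
  have "?C * (fps_X * ?W + ?L) * (u * v * w)
      = ?C * (fps_X * (?W * u * v * w) + (?L * w) * u * v)" by (simp add: algebra_simps)
  \<comment> \<open>The term \<open>?L\<close> was added so that its contribution
    \<open>fps_X * u * v\<close> cancels the \<open>- u * v\<close> in \<open>W\<close>.\<close>
  also have "\<dots> = ?C * (fps_X * fps_X * ?H * w)" unfolding W L by (simp add: algebra_simps)
  also have "\<dots> = (?P * u) * (?Q * v) * ?H * w" unfolding P Q C by (simp only: ac_simps)
  also have "\<dots> = ?P * ?Q * ?H * (u * v * w)" by (simp only: ac_simps)
  finally show ?thesis using nz by simp
qed

section \<open>Comparison of coefficients\<close>

theorem theorem3:
  fixes a b m :: nat and lam :: complex
  assumes "a > 0" and "b > 0" and "gcd a b = 1"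
    and "lam \<noteq> 0" and "lam ^ a = 1" and "lam ^ b \<noteq> 1"
  shows "weighted_sylvester_sum lam m a b =
    (\<Sum>l=0..m+1. \<Sum>i=0..l.
        of_nat ((m + 1) choose l) * of_nat (l choose i)
        * (of_nat a ^ (m + i + 1 - l) * of_nat b ^ (m + 1 - i)
           / ((of_nat m - of_nat l + 2) * (of_nat m + 1) * lam))
        * bernoulli_number i * apostol_bernoulli (l - i) (lam ^ b))
    - apostol_bernoulli (m + 1) lam / ((of_nat m + 1) * lam)"
proof -
  define A B where "A = (of_nat a :: complex)" and "B = (of_nat b :: complex)"
  define S where "S = weighted_sylvester_sum lam m a b"
  define T where "T l i = of_nat ((m + 1) choose l) * of_nat (l choose i)
        * (A ^ (m + i + 1 - l) * B ^ (m + 1 - i)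
           / ((of_nat m - of_nat l + 2) * (of_nat m + 1) * lam))
        * bernoulli_number i * apostol_bernoulli (l - i) (lam ^ b)" for l i
  have nz: "A \<noteq> 0" "B \<noteq> 0" using assms by (auto simp: A_def B_def)
  have "coprime a b" using assms(3) by (simp add: coprime_iff_gcd_eq_1)
  from arg_cong[OF weighted_sylvester_gf[OF assms(1,2) this assms(5,6)],
      of "\<lambda>F. fps_nth F (m + 1)"]
  have "A * B * (lam * S / fact m + apostol_bernoulli (m + 1) lam / fact (m + 1))
    = (\<Sum>l=0..m+1. (\<Sum>i=0..l. A ^ i * bernoulli_number i / fact i
          * (B ^ (l - i) * apostol_bernoulli (l - i) (lam ^ b) / fact (l - i)))
        * ((A * B) ^ Suc (m + 1 - l) / fact (Suc (m + 1 - l))))"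
    (is "_ = ?rhs")
    unfolding A_def B_def S_def
    \<comment> \<open>The fixed shapes of the first factor confine the Cauchy product to the triple
      product on the right.\<close>
    by (simp only: fps_mult_left_const_nth fps_add_nth fps_mult_nth[of "_ * _"]
        fps_mult_nth[of "Abs_fps _"] fps_nth_Abs_fps
        fps_X_mult_nth NR_exponential_sum_nth[OF assms(4)] of_nat_mult)
      (simp del: sum.atLeast0_atMost_Suc sum.cl_ivl_Suc)
  also have "?rhs = (\<Sum>l=0..m+1. \<Sum>i=0..l. A * B * lam / fact m * T l i)"
    unfolding sum_distrib_right
  proof (intro sum.cong refl)
    fix l i assume "l \<in> {0..m+1}" "i \<in> {0..l}"
    then have li: "l \<le> m + 1" "i \<le> l" by auto
    \<comment> \<open>With \<open>i + j + k = m + 1\<close> all truncated differences become sums,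
      and the two binomials form one trinomial coefficient.\<close>
    define k j where "k = m + 1 - l" and "j = l - i"
    have l: "l = i + j" and k: "m + 1 = i + j + k" using li by (auto simp: k_def j_def)
    have e: "m + i + 1 - l = i + k" "m + 1 - i = j + k" using l k by auto
    have mm: "of_nat m + 1 = (of_nat (m + 1) :: complex)" by simp
    \<comment> \<open>This denominator is the factor by which \<open>fact (Suc k)\<close> exceeds
      the \<open>fact k\<close> of the trinomial coefficient.\<close>
    have d: "of_nat m - of_nat l + 2 = (of_nat (Suc k) :: complex)"
    proof -
      have "of_nat (m + 1) = (of_nat (l + k) :: complex)" using l k by simp
      then show ?thesis by (simp add: algebra_simps)
    qed
    have bin: "of_nat ((m + 1) choose l) * of_nat (l choose i)
        = (fact (m + 1) / (fact i * fact j * fact k) :: complex)"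
      using li by (simp add: binomial_fact k_def j_def)
    have fm: "fact (m + 1) = of_nat (m + 1) * (fact m :: complex)" by simp
    have fk: "fact (Suc k) = of_nat (Suc k) * (fact k :: complex)" by simp
    have nzz: "of_nat (m + 1) \<noteq> (0::complex)" "of_nat (Suc k) \<noteq> (0::complex)"
      by (simp_all del: of_nat_Suc of_nat_add)
    show "A ^ i * bernoulli_number i / fact i
          * (B ^ (l - i) * apostol_bernoulli (l - i) (lam ^ b) / fact (l - i))
        * ((A * B) ^ Suc (m + 1 - l) / fact (Suc (m + 1 - l))) = A * B * lam / fact m * T l i"
      unfolding T_def e d mm bin fm k_def[symmetric] j_def[symmetric] fk
      using nzz nz assms(4)
      by (simp add: field_simps power_add del: of_nat_Suc of_nat_add)
  qed
  also have "\<dots> = A * B * lam / fact m * (\<Sum>l=0..m+1. \<Sum>i=0..l. T l i)"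
    by (simp only: sum_distrib_left)
  also have "A * B * (lam * S / fact m + apostol_bernoulli (m + 1) lam / fact (m + 1))
    = A * B * lam / fact m * (S + apostol_bernoulli (m + 1) lam / ((of_nat m + 1) * lam))"
  proof -
    define M where "M = of_nat m + (1 :: complex)"
    have "fact (m + 1) = M * (fact m :: complex)" by (simp add: M_def)
    moreover have "M \<noteq> 0"
      unfolding M_def by (metis of_nat_neq_0 of_nat_Suc add.commute)
    ultimately show ?thesis
      using assms(4) unfolding M_def[symmetric] by (simp add: field_simps del: fact_Suc)
  qed
  finally have "S + apostol_bernoulli (m + 1) lam / ((of_nat m + 1) * lam)
    = (\<Sum>l=0..m+1. \<Sum>i=0..l. T l i)"
    using nz assms(4) by simp
  then show ?thesis
    unfolding S_def T_def A_def B_def by (simp only: eq_diff_eq)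
qed

end
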